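(* Let $X$ be a real Hilbert space, let $f,g\colon X\to\,]-\infty,+\infty]$ be proper lower semicontinuous convex functions, let $\lambda\in\,]0,1[$ and set $T_\lambda=(1-\lambda)\mathrm{Id}+\lambda R_gR_f$. Let $\mathsf v=P_{\overline{\operatorname{ran}}(\mathrm{Id}-T)}(0)$, where $T=\tfrac12(\mathrm{Id}+R_gR_f)$, and let $Z=\{x\in X: 0\in-\mathsf v+\partial f(x)+\partial g(x-\mathsf v)\}$. Suppose that $Z\neq\varnothing$ and that there exists $h\in\{f,g\}$ such that $h$ is uniformly convex on $X$. Then there exists $\overline{x}\in X$ such that $Z=\operatorname{argmin}\big(-\langle\cdot,\mathsf v\rangle+f+g(\cdot-\mathsf v)\big)=\{\overline{x}\}$. Moreover, for every $x\in X$ the following hold (convergence in norm as $n\to\infty$): (i) $\operatorname{Prox}_fT_\lambda^nx\to\overline{x}$. (ii) $\operatorname{Prox}_gR_fT_\lambda^nx\to\overline{x}-\mathsf v$.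
   Context: $\operatorname{Prox}_f=(\mathrm{Id}+\partial f)^{-1}$ is the proximal mapping of $f$, $R_f=2\operatorname{Prox}_f-\mathrm{Id}$, and similarly for $g$; $\partial f$ is the convex subdifferential. The set $\overline{\operatorname{ran}}(\mathrm{Id}-T)$ is the closure of the range of $\mathrm{Id}-T$; it is nonempty, closed and convex, and $P_D$ denotes the metric projection onto a nonempty closed convex set $D$. $\operatorname{argmin}$ denotes the set of minimizers over $X$. A proper function $h$ is uniformly convex with modulus $\phi\colon\mathbb{R}_+\to[0,+\infty]$ if $\phi$ is increasing, vanishes only at $0$, and $h(\alpha x+(1-\alpha)y)+\alpha(1-\alpha)\phi(\|x-y\|)\le\alpha h(x)+(1-\alpha)h(y)$ for all $x,y\in\operatorname{dom}h$ and $\alpha\in\,]0,1[$; it is uniformly convex if this holds for some such $\phi$. *)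

theory Defs
  imports "HOL-Analysis.Analysis"
begin

text \<open>
  A function \<open>X \<rightarrow> ]-\<infinity>,+\<infinity>]\<close> is represented by an \<^typ>\<open>ereal\<close>-valued function; properness
  carries the requirement that the value \<open>-\<infinity>\<close> is never taken.
\<close>

definition proper_fun :: "('a \<Rightarrow> ereal) \<Rightarrow> bool" where
  "proper_fun f \<longleftrightarrow> (\<forall>x. f x \<noteq> -\<infinity>) \<and> (\<exists>x. f x \<noteq> \<infinity>)"

definition effective_domain :: "('a \<Rightarrow> ereal) \<Rightarrow> 'a set" where
  "effective_domain f = {x. f x < \<infinity>}"

definition lsc_fun :: "('a::topological_space \<Rightarrow> ereal) \<Rightarrow> bool" where
  "lsc_fun f \<longleftrightarrow> (\<forall>x. f x \<le> Liminf (nhds x) f)"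

definition convex_fun :: "('a::real_vector \<Rightarrow> ereal) \<Rightarrow> bool" where
  "convex_fun f \<longleftrightarrow>
     (\<forall>x\<in>effective_domain f. \<forall>y\<in>effective_domain f. \<forall>\<alpha>\<in>{0<..<1}.
        f (\<alpha> *\<^sub>R x + (1 - \<alpha>) *\<^sub>R y) \<le> ereal \<alpha> * f x + ereal (1 - \<alpha>) * f y)"

text \<open>The modulus is only relevant on \<open>[0,+\<infinity>[\<close>; ``increasing'' means nondecreasing.\<close>

definition uniformly_convex_with_modulus ::
    "('a::real_normed_vector \<Rightarrow> ereal) \<Rightarrow> (real \<Rightarrow> ereal) \<Rightarrow> bool" where
  "uniformly_convex_with_modulus h \<phi> \<longleftrightarrow>
     proper_fun h \<and>
     (\<forall>t\<ge>0. 0 \<le> \<phi> t) \<and> mono_on {0..} \<phi> \<and> (\<forall>t\<ge>0. \<phi> t = 0 \<longleftrightarrow> t = 0) \<and>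
     (\<forall>x\<in>effective_domain h. \<forall>y\<in>effective_domain h. \<forall>\<alpha>\<in>{0<..<1}.
        h (\<alpha> *\<^sub>R x + (1 - \<alpha>) *\<^sub>R y) + ereal (\<alpha> * (1 - \<alpha>)) * \<phi> (norm (x - y))
          \<le> ereal \<alpha> * h x + ereal (1 - \<alpha>) * h y)"

definition uniformly_convex_fun :: "('a::real_normed_vector \<Rightarrow> ereal) \<Rightarrow> bool" where
  "uniformly_convex_fun h \<longleftrightarrow> (\<exists>\<phi>. uniformly_convex_with_modulus h \<phi>)"

text \<open>For proper \<open>f\<close>, the subdifferential is empty at every point where \<open>f\<close> is \<open>+\<infinity>\<close>.\<close>

definition subdifferential :: "('a::real_inner \<Rightarrow> ereal) \<Rightarrow> 'a \<Rightarrow> 'a set" where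
  "subdifferential f x = {u. \<forall>y. ereal (inner (y - x) u) + f x \<le> f y}"

text \<open>
  \<open>Prox f = (Id + \<partial>f)\<^sup>-\<^sup>1\<close>: the value at \<open>x\<close> is the \<open>p\<close> with \<open>x \<in> p + \<partial>f(p)\<close>, which exists and
  is unique when \<open>f\<close> is proper, lower semicontinuous and convex on a Hilbert space.
\<close>

definition Prox :: "('a::real_inner \<Rightarrow> ereal) \<Rightarrow> 'a \<Rightarrow> 'a" where
  "Prox f x = (THE p. x \<in> {p} + subdifferential f p)"

definition reflected_prox :: "('a::real_inner \<Rightarrow> ereal) \<Rightarrow> 'a \<Rightarrow> 'a" where
  "reflected_prox f x = 2 *\<^sub>R Prox f x - x"

text \<open>
  The library's \<^const>\<open>closest_point\<close> is restricted to \<^class>\<open>heine_borel\<close> spaces, hence to finite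
  dimension. The nearest point exists and is unique when \<open>D\<close> is a nonempty closed convex
  subset of a Hilbert space.
\<close>

definition metric_projection :: "'a::metric_space set \<Rightarrow> 'a \<Rightarrow> 'a" where
  "metric_projection D x = (THE p. p \<in> D \<and> (\<forall>y\<in>D. dist x p \<le> dist x y))"

definition argmin_set :: "('a \<Rightarrow> ereal) \<Rightarrow> 'a set" where
  "argmin_set F = {x. is_arg_min F (\<lambda>_. True) x}"

end

theory Submission
  imports Defs
begin

text \<open>
  Write \<open>A = Prox\<^sub>f - Prox\<^sub>g R\<^sub>f = Id - T\<close>, so that \<open>T\<^sub>\<lambda> = Id - 2\<lambda>A\<close>. For two points, the inner product
  of their difference with the difference of the values of \<open>A\<close> is the squared norm of the latter plus
  two nonnegative monotonicity gaps, one for \<open>\<partial>f\<close> and one for \<open>\<partial>g\<close>. If \<open>v \<in> \<partial>f(z) + \<partial>g(z - v)\<close> with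
  \<open>u\<close> the summand in \<open>\<partial>f(z)\<close>, then \<open>y = z + u\<close> satisfies \<open>A y = v\<close>, and minimality of \<open>v\<close> forces
  \<open>A(y - s v) = v\<close> and vanishing gaps for all \<open>s \<ge> 0\<close>; hence \<open>T\<^sub>\<lambda>\<^sup>n y = y - 2n\<lambda>v\<close>. The squared distance of
  \<open>T\<^sub>\<lambda>\<^sup>n x\<close> to \<open>T\<^sub>\<lambda>\<^sup>n y\<close> decreases by a positive combination of the gaps and the squared difference of
  displacements, so these tend to \<open>0\<close>. Uniform convexity of \<open>f\<close> or \<open>g\<close> turns a vanishing gap into norm
  convergence of the proximal points, and the proximal points of \<open>T\<^sub>\<lambda>\<^sup>n y\<close> stay at \<open>z\<close> and \<open>z - v\<close>.
\<close>

section \<open>Subgradient inequalities and convexity in real terms\<close>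

lemma proper_fun_finite:
  assumes "proper_fun f" "f x < \<infinity>"
  obtains r where "f x = ereal r"
  using assms by (cases "f x") (auto simp: proper_fun_def)

lemma subdifferential_finite:
  assumes "proper_fun f" "u \<in> subdifferential f x"
  obtains r where "f x = ereal r"
proof -
  obtain y where "f y \<noteq> \<infinity>" using assms(1) by (auto simp: proper_fun_def)
  moreover have "ereal (inner (y - x) u) + f x \<le> f y"
    using assms(2) by (auto simp: subdifferential_def)
  ultimately have "f x < \<infinity>" by (cases "f x") auto
  then show ?thesis using proper_fun_finite[OF assms(1)] that by blast
qed

lemma subdifferentialD:
  assumes "u \<in> subdifferential f x" "f x = ereal r" "f y = ereal s"
  shows "inner (y - x) u + r \<le> s"
proof -
  have "ereal (inner (y - x) u) + f x \<le> f y"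
    using assms(1) by (auto simp: subdifferential_def)
  then show ?thesis using assms(2,3) by simp
qed

lemma subdifferential_monotone:
  assumes "proper_fun f" "u \<in> subdifferential f x" "w \<in> subdifferential f y"
  shows "0 \<le> inner (x - y) (u - w)"
proof -
  obtain r where r: "f x = ereal r" using subdifferential_finite[OF assms(1,2)] .
  obtain s where s: "f y = ereal s" using subdifferential_finite[OF assms(1,3)] .
  show ?thesis
    using subdifferentialD[OF assms(2) r s] subdifferentialD[OF assms(3) s r]
    by (simp add: inner_diff_left inner_diff_right)
qed

lemma convex_funD:
  assumes "proper_fun f" "convex_fun f" "f x = ereal r" "f y = ereal s" "0 < t" "t < 1"
  obtains q where "f (t *\<^sub>R x + (1 - t) *\<^sub>R y) = ereal q" "q \<le> t * r + (1 - t) * s"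
proof -
  have le: "f (t *\<^sub>R x + (1 - t) *\<^sub>R y) \<le> ereal t * f x + ereal (1 - t) * f y"
    using assms(2)[unfolded convex_fun_def, rule_format, of x y t] assms(3-6)
    by (simp add: effective_domain_def)
  also have "\<dots> = ereal (t * r + (1 - t) * s)" using assms by simp
  finally have le: "f (t *\<^sub>R x + (1 - t) *\<^sub>R y) \<le> ereal (t * r + (1 - t) * s)" .
  then have "f (t *\<^sub>R x + (1 - t) *\<^sub>R y) < \<infinity>"
    using ereal_infty_less_eq2(1) less_ereal.simps(4) order_le_less_trans by metis
  then obtain q where "f (t *\<^sub>R x + (1 - t) *\<^sub>R y) = ereal q"
    using proper_fun_finite[OF assms(1)] by blast
  with le that show ?thesis by auto
qed

section \<open>Existence and uniqueness of the proximal point\<close>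

text \<open>Near a point of the domain \<open>f\<close> is bounded below by semicontinuity; convexity along rays
  then limits the rate at which \<open>f\<close> can decrease. No separation theorem is involved.\<close>

lemma lsc_convex_minorant:
  fixes f :: "'a::real_normed_vector \<Rightarrow> ereal"
  assumes f: "proper_fun f" "lsc_fun f" "convex_fun f"
  shows "\<exists>c d. \<forall>y. ereal (c - d * norm (y - x)) \<le> f y"
proof -
  obtain x0 where "f x0 \<noteq> \<infinity>" using f(1) by (auto simp: proper_fun_def)
  then obtain r where r: "f x0 = ereal r"
    using proper_fun_finite[OF f(1), of x0] by auto
  have "f x0 \<le> Liminf (nhds x0) f" using f(2) by (auto simp: lsc_fun_def)
  then have "\<forall>y<f x0. eventually (\<lambda>x. y < f x) (nhds x0)"
    unfolding le_Liminf_iff .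
  then have "eventually (\<lambda>x. ereal (r - 1) < f x) (nhds x0)"
    using r by auto
  then obtain e where e: "e > 0" "\<And>y. dist y x0 < e \<Longrightarrow> ereal (r - 1) < f y"
    unfolding eventually_nhds_metric by blast
  have main: "ereal (r - 1 - 2 / e * norm (y - x0)) \<le> f y" for y
  proof (cases "f y = \<infinity>")
    case False
    then obtain s where s: "f y = ereal s"
      using proper_fun_finite[OF f(1), of y] by auto
    have "r - 1 - 2 / e * norm (y - x0) \<le> s"
    proof (cases "dist y x0 < e")
      case True
      have "0 \<le> 2 / e * norm (y - x0)" using e(1) by simp
      then show ?thesis using e(2)[OF True] s by simp
    next
      case False
      define N where "N = norm (y - x0)"
      have N: "N \<ge> e" using False by (simp add: N_def dist_norm)
      \<comment> \<open>This \<open>t\<close> puts the convex combination at distance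
        \<open>e / 2\<close> from \<open>x0\<close>, inside the ball where \<open>f\<close> exceeds
        \<open>r - 1\<close>. The slope \<open>2 / e\<close> comes from
        \<open>1 / t = 2 / e * N\<close>.\<close>
      define t where "t = e / (2 * N)"
      have t: "0 < t" "t < 1" "t * N = e / 2"
        using N e(1) by (auto simp: t_def divide_simps)
      obtain q where q: "f (t *\<^sub>R y + (1 - t) *\<^sub>R x0) = ereal q" "q \<le> t * s + (1 - t) * r"
        using convex_funD[OF f(1,3) s r t(1,2)] .
      have "t *\<^sub>R y + (1 - t) *\<^sub>R x0 - x0 = t *\<^sub>R (y - x0)"
        by (simp add: algebra_simps)
      then have "dist (t *\<^sub>R y + (1 - t) *\<^sub>R x0) x0 = e / 2"
        using t by (simp add: dist_norm N_def)
      then have "r - 1 < q" using e(2)[of "t *\<^sub>R y + (1 - t) *\<^sub>R x0"] e(1) q(1) by simp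
      then have "t * (r - s) < 1" using q(2) by (simp add: algebra_simps)
      then have "r - s < 1 / t" using t(1) by (simp add: field_simps)
      also have "1 / t = 2 / e * N" using N e(1) by (simp add: t_def)
      finally show ?thesis by (simp add: N_def)
    qed
    then show ?thesis using s by simp
  qed simp
  \<comment> \<open>The bound is centred at \<open>x0\<close>; the triangle inequality moves the
    centre to \<open>x\<close> at the cost of a constant.\<close>
  have "ereal ((r - 1 - 2 / e * norm (x - x0)) - 2 / e * norm (y - x)) \<le> f y" for y
  proof -
    have "norm (y - x0) \<le> norm (x - x0) + norm (y - x)"
      using norm_triangle_ineq[of "x - x0" "y - x"] by (simp add: algebra_simps)
    then have "2 / e * norm (y - x0) \<le> 2 / e * (norm (x - x0) + norm (y - x))"
      using e(1) by (intro mult_left_mono) auto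
    then have "(r - 1 - 2 / e * norm (x - x0)) - 2 / e * norm (y - x)
        \<le> r - 1 - 2 / e * norm (y - x0)"
      by (simp add: algebra_simps)
    then show ?thesis using main[of y] by (meson ereal_less_eq(3) order_trans)
  qed
  then show ?thesis by blast
qed

text \<open>Minty's theorem for subdifferentials: minimize \<open>f + \<parallel>\<cdot> - x\<parallel>\<^sup>2/2\<close>. By the parallelogram law
  minimizing sequences are Cauchy.\<close>

lemma subdifferential_resolvent_exists:
  fixes f :: "'a::{real_inner, complete_space} \<Rightarrow> ereal"
  assumes f: "proper_fun f" "lsc_fun f" "convex_fun f"
  shows "\<exists>p. x - p \<in> subdifferential f p"
proof -
  define D where "D = {y. f y < \<infinity>}"
  define r where "r y = real_of_ereal (f y)" for y
  have r: "f y = ereal (r y)" if "y \<in> D" for y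
    using that f(1) by (cases "f y") (auto simp: D_def r_def proper_fun_def)
  have D_conv: "t *\<^sub>R y + (1 - t) *\<^sub>R z \<in> D"
      "r (t *\<^sub>R y + (1 - t) *\<^sub>R z) \<le> t * r y + (1 - t) * r z"
    if yz: "y \<in> D" "z \<in> D" and t: "0 < t" "t < 1" for y z t
  proof -
    obtain q where "f (t *\<^sub>R y + (1 - t) *\<^sub>R z) = ereal q" "q \<le> t * r y + (1 - t) * r z"
      using convex_funD[OF f(1,3) r[OF yz(1)] r[OF yz(2)] t] .
    then show "t *\<^sub>R y + (1 - t) *\<^sub>R z \<in> D"
        "r (t *\<^sub>R y + (1 - t) *\<^sub>R z) \<le> t * r y + (1 - t) * r z"
      by (auto simp: D_def r_def)
  qed
  have D_ne: "D \<noteq> {}" using f(1) by (auto simp: D_def proper_fun_def)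
  define F where "F y = r y + (norm (y - x))\<^sup>2 / 2" for y
  obtain c d where cd: "\<And>y. ereal (c - d * norm (y - x)) \<le> f y"
    using lsc_convex_minorant[OF f] by blast
  \<comment> \<open>Completing the square: the quadratic term of \<open>F\<close> outgrows the
    linear loss in the minorant.\<close>
  have "c - d\<^sup>2 / 2 \<le> F y" if "y \<in> D" for y
  proof -
    have "c - d * norm (y - x) \<le> r y" using cd[of y] r[OF that] by simp
    moreover have "0 \<le> (norm (y - x) - d)\<^sup>2" by simp
    ultimately show ?thesis by (simp add: F_def power2_diff algebra_simps)
  qed
  then have bdd: "bdd_below (F ` D)" by (intro bdd_belowI2) auto
  define m where "m = Inf (F ` D)"
  have m_le: "m \<le> F y" if "y \<in> D" for y
    unfolding m_def using bdd that by (intro cInf_lower) auto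
  have "\<exists>y\<in>D. F y < m + inverse (real (Suc n))" for n
  proof -
    have "Inf (F ` D) < m + inverse (real (Suc n))" by (simp add: m_def)
    then show ?thesis using cInf_less_iff[of "F ` D"] bdd D_ne by auto
  qed
  then obtain s where s: "\<And>n. s n \<in> D" "\<And>n. F (s n) < m + inverse (real (Suc n))"
    by metis
  have close: "(norm (y - z))\<^sup>2 \<le> 4 * ((F y - m) + (F z - m))" if yz: "y \<in> D" "z \<in> D" for y z
  proof -
    define w where "w = (1/2) *\<^sub>R y + (1 - 1/2) *\<^sub>R z"
    have w: "w \<in> D" "r w \<le> 1/2 * r y + (1 - 1/2) * r z"
      unfolding w_def using D_conv[OF yz, of "1/2"] by simp_all
    have "w - x = (1/2) *\<^sub>R ((y - x) + (z - x))"
      by (simp add: w_def algebra_simps flip: scaleR_add_left)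
    then have "(norm (w - x))\<^sup>2 = (norm ((y - x) + (z - x)))\<^sup>2 / 4"
      by (simp add: power_mult_distrib power_divide)
    moreover have "(norm ((y - x) + (z - x)))\<^sup>2 + (norm (y - z))\<^sup>2
        = 2 * (norm (y - x))\<^sup>2 + 2 * (norm (z - x))\<^sup>2"
      by (simp add: power2_norm_eq_inner inner_simps inner_commute)
    ultimately show ?thesis using w(2) m_le[OF w(1)] by (simp add: F_def)
  qed
  have "Cauchy s"
  proof (rule metric_CauchyI)
    fix e :: real assume e: "0 < e"
    \<comment> \<open>In \<open>close\<close> the sum of two excesses over \<open>m\<close> is
      multiplied by 4, so an excess below one eighth of the square of \<open>e\<close>
      suffices.\<close>
    then have "0 < e\<^sup>2 / 8" by simp
    then obtain M where M: "inverse (real (Suc M)) < e\<^sup>2 / 8"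
      using reals_Archimedean by blast
    have small: "F (s n) - m < e\<^sup>2 / 8" if "n \<ge> M" for n
    proof -
      have "inverse (real (Suc n)) \<le> inverse (real (Suc M))" using that by simp
      then show ?thesis using s(2)[of n] M by linarith
    qed
    have "dist (s i) (s j) < e" if "i \<ge> M" "j \<ge> M" for i j
    proof -
      have "(norm (s i - s j))\<^sup>2 < e\<^sup>2"
        using close[OF s(1) s(1), of i j] small[OF that(1)] small[OF that(2)] by simp
      then show ?thesis using e by (simp add: dist_norm power2_less_imp_less)
    qed
    then show "\<exists>M. \<forall>m\<ge>M. \<forall>n\<ge>M. dist (s m) (s n) < e" by blast
  qed
  then obtain p where p: "s \<longlonglongrightarrow> p"
    using Cauchy_convergent convergent_def by blast
  have Fs: "(\<lambda>n. F (s n)) \<longlonglongrightarrow> m"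
  proof (rule tendsto_sandwich[of "\<lambda>_. m" _ _ "\<lambda>n. m + inverse (real (Suc n))"])
    show "(\<lambda>n. m + inverse (real (Suc n))) \<longlonglongrightarrow> m"
      using tendsto_add[OF tendsto_const[of m] LIMSEQ_inverse_real_of_nat] by simp
  qed (use m_le s in \<open>auto intro!: always_eventually less_imp_le\<close>)
  \<comment> \<open>Lower semicontinuity along \<open>s\<close>. Testing against every
    \<open>C < f p\<close> works before \<open>f p\<close> is known to be finite; finiteness then
    follows from the bound.\<close>
  have fp_le: "f p \<le> ereal (m - (norm (p - x))\<^sup>2 / 2)"
  proof (rule dense_le)
    fix C assume C: "C < f p"
    have "f p \<le> Liminf (nhds p) f" using f(2) by (auto simp: lsc_fun_def)
    then have "eventually (\<lambda>y. C < f y) (nhds p)"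
      using C unfolding le_Liminf_iff by blast
    then have ev: "eventually (\<lambda>n. C < f (s n)) sequentially"
      using p by (rule eventually_compose_filterlim)
    have "(\<lambda>n. F (s n) - (norm (s n - x))\<^sup>2 / 2) \<longlonglongrightarrow> m - (norm (p - x))\<^sup>2 / 2"
      by (intro tendsto_intros Fs p) simp
    then have "(\<lambda>n. ereal (F (s n) - (norm (s n - x))\<^sup>2 / 2)) \<longlonglongrightarrow> ereal (m - (norm (p - x))\<^sup>2 / 2)"
      by simp
    then show "C \<le> ereal (m - (norm (p - x))\<^sup>2 / 2)"
    proof (rule tendsto_lowerbound)
      show "eventually (\<lambda>n. C \<le> ereal (F (s n) - (norm (s n - x))\<^sup>2 / 2)) sequentially"
        using ev by eventually_elim (simp add: F_def r[OF s(1), symmetric] less_imp_le)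
    qed simp
  qed
  then have pD: "p \<in> D" unfolding D_def
    by (metis less_ereal.simps(4) mem_Collect_eq order_le_less_trans)
  have Fp: "F p \<le> m" using fp_le r[OF pD] by (simp add: F_def)
  have "ereal (inner (y - p) (x - p)) + f p \<le> f y" for y
  proof (cases "y \<in> D")
    case False
    then show ?thesis by (simp add: D_def)
  next
    case True
    have norm_step: "(norm ((p - x) + t *\<^sub>R (y - p)))\<^sup>2
        = (norm (p - x))\<^sup>2 - 2 * t * inner (y - p) (x - p) + t\<^sup>2 * (norm (y - p))\<^sup>2" for t
    proof -
      have "inner (y - p) (x - p) = - inner (p - x) (y - p)"
        by (simp add: inner_simps inner_commute)
      then show ?thesis
        unfolding power2_norm_eq_inner
        by (simp add: inner_add_left inner_add_right inner_commute power2_eq_square)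
    qed
    \<comment> \<open>First-order optimality: compare \<open>p\<close> with a point of the segment
      towards \<open>y\<close>, divide by \<open>t\<close>, and later let \<open>t\<close> tend to
      0.\<close>
    have step: "inner (y - p) (x - p) + r p - r y \<le> t * ((norm (y - p))\<^sup>2 / 2)"
      if t: "0 < t" "t < 1" for t
    proof -
      define w where "w = t *\<^sub>R y + (1 - t) *\<^sub>R p"
      have w: "w \<in> D" "r w \<le> t * r y + (1 - t) * r p"
        unfolding w_def using D_conv[OF True pD t] by simp_all
      have w_x: "w - x = (p - x) + t *\<^sub>R (y - p)" by (simp add: w_def algebra_simps)
      have "(norm (w - x))\<^sup>2
          = (norm (p - x))\<^sup>2 - 2 * t * inner (y - p) (x - p) + t\<^sup>2 * (norm (y - p))\<^sup>2"
        by (simp only: w_x norm_step)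
      then have "t * (inner (y - p) (x - p) + r p - r y) \<le> t * (t * ((norm (y - p))\<^sup>2 / 2))"
        using m_le[OF w(1)] Fp w(2) by (simp add: F_def algebra_simps power2_eq_square)
      then show ?thesis using t(1) by simp
    qed
    have "inner (y - p) (x - p) + r p - r y \<le> 0"
    proof (rule tendsto_lowerbound)
      show "((\<lambda>t. t * ((norm (y - p))\<^sup>2 / 2)) \<longlongrightarrow> 0) (at_right 0)"
        by (auto intro!: tendsto_eq_intros)
      show "eventually (\<lambda>t. inner (y - p) (x - p) + r p - r y \<le> t * ((norm (y - p))\<^sup>2 / 2))
          (at_right 0)"
        unfolding eventually_at_right_field using step by (intro exI[of _ 1]) auto
    qed simp
    then show ?thesis using r[OF True] r[OF pD] by simp
  qed
  then show ?thesis by (auto simp: subdifferential_def)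
qed

text \<open>Two solutions \<open>p\<close> and \<open>q\<close> for the same \<open>x\<close> have
  subgradients differing by \<open>p - q\<close>, so monotonicity makes the squared norm of
  \<open>q - p\<close> nonpositive. This resolves the definite description.\<close>

lemma Prox_eqI:
  assumes "proper_fun f" "x - p \<in> subdifferential f p"
  shows "Prox f x = p"
  unfolding Prox_def
proof (rule the_equality)
  show "x \<in> {p} + subdifferential f p"
    using assms(2) by (auto simp: set_plus_def intro!: bexI[of _ "x - p"])
next
  fix q assume "x \<in> {q} + subdifferential f q"
  then have "x - q \<in> subdifferential f q" by (auto simp: set_plus_def)
  from subdifferential_monotone[OF assms(1) this assms(2)]
  have "inner (q - p) (q - p) \<le> 0" by (simp add: inner_simps)
  then show "q = p" by (metis inner_gt_zero_iff linorder_not_less right_minus_eq)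
qed

lemma Prox_subdifferential:
  fixes f :: "'a::{real_inner, complete_space} \<Rightarrow> ereal"
  assumes "proper_fun f" "lsc_fun f" "convex_fun f"
  shows "x - Prox f x \<in> subdifferential f (Prox f x)"
  using subdifferential_resolvent_exists[OF assms, of x] Prox_eqI[OF assms(1)] by metis

section \<open>Uniform convexity and strong monotonicity of the subdifferential\<close>

lemma uniformly_convexD:
  assumes "uniformly_convex_with_modulus h \<phi>" "h x = ereal r" "h y = ereal s"
  obtains q where "h ((1/2) *\<^sub>R x + (1/2) *\<^sub>R y) = ereal q"
    "ereal q + ereal (1/4) * \<phi> (norm (x - y)) \<le> ereal ((r + s) / 2)"
proof -
  define w where "w = (1/2::real) *\<^sub>R x + (1 - 1/2::real) *\<^sub>R y"
  have le: "h w + ereal (1/2 * (1 - 1/2)) * \<phi> (norm (x - y)) \<le> ereal (1/2) * h x + ereal (1 - 1/2) * h y"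
    unfolding w_def
    using assms unfolding uniformly_convex_with_modulus_def effective_domain_def
    by (metis (mono_tags, lifting) field_sum_of_halves greaterThanLessThan_iff half_gt_zero_iff
        less_ereal.simps(4) less_add_same_cancel1 mem_Collect_eq zero_less_one)
  also have "\<dots> = ereal ((r + s) / 2)" using assms(2,3) by simp
  finally have le: "h w + ereal (1/4) * \<phi> (norm (x - y)) \<le> ereal ((r + s) / 2)" by simp
  have "0 \<le> \<phi> (norm (x - y))" and proper: "proper_fun h"
    using assms(1) by (auto simp: uniformly_convex_with_modulus_def)
  then have "h w < \<infinity>" using le by (cases "h w"; cases "\<phi> (norm (x - y))") auto
  then obtain q where q: "h w = ereal q" using proper_fun_finite[OF proper] by blast
  show ?thesis using that[of q] q le by (simp add: w_def)
qed

text \<open>Both subgradient inequalities are evaluated at the midpoint. Their average bounds the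
  drop of \<open>h\<close> there by a quarter of the inner product, which matches the factor 1/4 of
  the modulus at the midpoint.\<close>

lemma uniformly_convex_subdifferential:
  assumes "uniformly_convex_with_modulus h \<phi>"
    and "u \<in> subdifferential h x" "w \<in> subdifferential h y"
  shows "\<phi> (norm (x - y)) \<le> ereal (inner (x - y) (u - w))"
proof -
  have proper: "proper_fun h" and pos: "0 \<le> \<phi> (norm (x - y))"
    using assms(1) by (auto simp: uniformly_convex_with_modulus_def)
  obtain r where r: "h x = ereal r" using subdifferential_finite[OF proper assms(2)] .
  obtain s where s: "h y = ereal s" using subdifferential_finite[OF proper assms(3)] .
  obtain q where q: "h ((1/2) *\<^sub>R x + (1/2) *\<^sub>R y) = ereal q"
    "ereal q + ereal (1/4) * \<phi> (norm (x - y)) \<le> ereal ((r + s) / 2)"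
    using uniformly_convexD[OF assms(1) r s] .
  have "(1/2) *\<^sub>R x + (1/2) *\<^sub>R y - x = (1/2) *\<^sub>R (y - x)"
    "(1/2) *\<^sub>R x + (1/2) *\<^sub>R y - y = (1/2) *\<^sub>R (x - y)"
    by (simp_all add: algebra_simps flip: scaleR_add_left)
  then have "inner (y - x) u / 2 + r \<le> q" "inner (x - y) w / 2 + s \<le> q"
    using subdifferentialD[OF assms(2) r q(1)] subdifferentialD[OF assms(3) s q(1)] by simp_all
  then have "(r + s) / 2 - q \<le> inner (x - y) (u - w) / 4"
    by (simp add: inner_simps field_simps)
  then show ?thesis using q(2) pos by (cases "\<phi> (norm (x - y))") (auto simp: field_simps)
qed

text \<open>If \<open>norm (a n)\<close> were at least \<open>t\<close>, monotonicity of the modulus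
  would give \<open>\<phi> t \<le> e n\<close>, while \<open>e n\<close> eventually falls below a
  positive level. A real level \<open>c\<close> is taken since \<open>\<phi> t\<close> may be
  infinite.\<close>

lemma uniformly_convex_modulus_tendsto:
  assumes "uniformly_convex_with_modulus h \<phi>"
    and "\<And>n. \<phi> (norm (a n)) \<le> ereal (e n)" "e \<longlonglongrightarrow> 0"
  shows "a \<longlonglongrightarrow> 0"
proof (rule tendstoI)
  fix t :: real assume t: "0 < t"
  have mono: "mono_on {0..} \<phi>" and pos: "0 < \<phi> t"
    using assms(1) t by (auto simp: uniformly_convex_with_modulus_def order_less_le)
  obtain c where c: "0 < c" "ereal c < \<phi> t"
    using ereal_dense2[OF pos] by (auto simp: zero_ereal_def)
  have "eventually (\<lambda>n. e n < c) sequentially"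
    using order_tendstoD(2)[OF assms(3) c(1)] .
  then show "eventually (\<lambda>n. dist (a n) 0 < t) sequentially"
  proof eventually_elim
    case (elim n)
    show ?case
    proof (rule ccontr)
      assume "\<not> dist (a n) 0 < t"
      then have "\<phi> t \<le> \<phi> (norm (a n))"
        using mono t by (auto simp: mono_on_def)
      also have "\<dots> \<le> ereal (e n)" by (rule assms(2))
      also have "\<dots> < ereal c" using elim by simp
      finally show False using c(2) by auto
    qed
  qed
qed

section \<open>The minimal displacement vector as a metric projection\<close>

text \<open>The minimal displacement vector is the limit of \<open>A x\<^sub>\<epsilon>\<close> as \<open>\<epsilon> \<rightarrow> 0\<close>, where
  \<open>A x\<^sub>\<epsilon> + \<epsilon> x\<^sub>\<epsilon> = 0\<close>. Convexity of the closed range is bypassed: the limit satisfies the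
  variational inequality directly.\<close>

lemma cocoercive_minimal_displacement:
  fixes A :: "'a::{real_inner, complete_space} \<Rightarrow> 'a"
  assumes A: "\<And>x y. (norm (A x - A y))\<^sup>2 \<le> inner (x - y) (A x - A y)"
  shows "\<exists>p\<in>closure (range A). \<forall>a\<in>closure (range A). inner p p \<le> inner a p"
proof -
  define e where "e n = inverse (real (Suc n))" for n
  have e0: "0 < e n" for n by (simp add: e_def)
  have nonexp: "norm ((x - A x) - (y - A y)) \<le> norm (x - y)" for x y
  proof -
    have "(norm ((x - A x) - (y - A y)))\<^sup>2
        = (norm (x - y))\<^sup>2 - 2 * inner (x - y) (A x - A y) + (norm (A x - A y))\<^sup>2"
      by (simp add: power2_norm_eq_inner inner_simps inner_commute)
    also have "\<dots> \<le> (norm (x - y))\<^sup>2" using A[of x y] zero_le_power2[of "norm (A x - A y)"] by linarith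
    finally show ?thesis by (rule power2_le_imp_le) simp
  qed
  have "\<exists>x. A x = - (e n *\<^sub>R x)" for n
  proof -
    \<comment> \<open>The regularized equation is the fixed point equation
      \<open>x = k *\<^sub>R (x - A x)\<close>; its right-hand side is a contraction with factor
      \<open>k\<close>, because \<open>Id - A\<close> is nonexpansive.\<close>
    define k where "k = 1 / (1 + e n)"
    have k: "0 \<le> k" "k < 1" "k * (1 + e n) = 1" using e0[of n] by (auto simp: k_def field_simps)
    have "\<exists>!x\<in>UNIV. k *\<^sub>R (x - A x) = x"
    proof (rule Banach_fix[of UNIV k])
      show "dist (k *\<^sub>R (x - A x)) (k *\<^sub>R (y - A y)) \<le> k * dist x y" for x y
      proof -
        have "k *\<^sub>R (x - A x) - k *\<^sub>R (y - A y) = k *\<^sub>R ((x - A x) - (y - A y))"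
          by (simp add: algebra_simps)
        then show ?thesis using nonexp[of x y] k(1)
          by (simp add: dist_norm mult_left_mono)
      qed
    qed (use k in \<open>auto simp: complete_UNIV\<close>)
    then obtain x where x: "k *\<^sub>R (x - A x) = x" by blast
    have "x - A x = (1 + e n) *\<^sub>R (k *\<^sub>R (x - A x))" using k(3) by (simp add: mult.commute)
    also have "\<dots> = x + e n *\<^sub>R x" by (subst x) (simp add: algebra_simps)
    finally have "A x = - (e n *\<^sub>R x)" by (simp add: algebra_simps eq_neg_iff_add_eq_0)
    then show ?thesis by blast
  qed
  then obtain X where X: "\<And>n. A (X n) = - (e n *\<^sub>R X n)" by metis
  define Y where "Y n = A (X n)" for n
  have XY: "X n = - ((1 / e n) *\<^sub>R Y n)" for n
    using e0[of n] by (simp add: Y_def X)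
  have mono: "0 \<le> inner (x - y) (A x - A y)" for x y
    using A[of x y] zero_le_power2[of "norm (A x - A y)"] by linarith
  \<comment> \<open>Monotonicity of \<open>A\<close> at \<open>X n\<close> and \<open>X k\<close>,
    with \<open>X\<close> expressed through \<open>Y\<close>, gives
    \<open>0 \<le> inner (Y k) (Y n - Y k)\<close>. The squared norms of \<open>Y\<close> therefore
    decrease, and their convergence makes \<open>Y\<close> Cauchy.\<close>
  have dec: "(norm (Y n - Y k))\<^sup>2 \<le> (norm (Y n))\<^sup>2 - (norm (Y k))\<^sup>2" if "n < k" for n k
  proof -
    have lt: "e k < e n" using that by (simp add: e_def)
    have "0 \<le> e n * e k * inner (X n - X k) (Y n - Y k)"
      using mono[of "X n" "X k"] e0[of n] e0[of k] by (simp add: Y_def)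
    also have "\<dots> = inner (e n *\<^sub>R Y k - e k *\<^sub>R Y n) (Y n - Y k)"
      using e0[of n] e0[of k] by (subst (1 2) XY) (simp add: inner_simps field_simps)
    also have "\<dots> = (e n - e k) * inner (Y k) (Y n - Y k) - e k * inner (Y n - Y k) (Y n - Y k)"
      by (simp add: inner_simps algebra_simps)
    finally have "0 \<le> (e n - e k) * inner (Y k) (Y n - Y k)"
      using e0[of k] inner_ge_zero[of "Y n - Y k"] by (smt (verit) mult_nonneg_nonneg)
    then have "0 \<le> inner (Y k) (Y n - Y k)" using lt by (simp add: zero_le_mult_iff)
    then show ?thesis
      by (simp add: power2_norm_eq_inner inner_simps inner_commute)
  qed
  have "decseq (\<lambda>n. (norm (Y n))\<^sup>2)"
    unfolding decseq_def
  proof (intro allI impI)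
    fix n k :: nat assume "n \<le> k"
    then show "(norm (Y k))\<^sup>2 \<le> (norm (Y n))\<^sup>2"
      using dec[of n k] zero_le_power2[of "norm (Y n - Y k)"] by (cases "n = k") (simp, linarith)
  qed
  then obtain L where L: "(\<lambda>n. (norm (Y n))\<^sup>2) \<longlonglongrightarrow> L"
    using decseq_convergent[of "\<lambda>n. (norm (Y n))\<^sup>2" 0] by auto
  have "Cauchy Y"
  proof (rule metric_CauchyI)
    fix t :: real assume t: "0 < t"
    have "Cauchy (\<lambda>n. (norm (Y n))\<^sup>2)" using L LIMSEQ_imp_Cauchy by blast
    then obtain M where M: "\<And>i j. i \<ge> M \<Longrightarrow> j \<ge> M \<Longrightarrow> dist ((norm (Y i))\<^sup>2) ((norm (Y j))\<^sup>2) < t\<^sup>2"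
      using t metric_CauchyD[of "\<lambda>n. (norm (Y n))\<^sup>2" "t\<^sup>2"] by (metis zero_less_power)
    have less: "dist (Y i) (Y j) < t" if "i \<ge> M" "i < j" for i j
    proof -
      have "(norm (Y i - Y j))\<^sup>2 < t\<^sup>2"
        using dec[OF that(2)] M[of i j] that by (simp add: dist_real_def)
      then show ?thesis using t by (simp add: dist_norm power2_less_imp_less)
    qed
    have "dist (Y i) (Y j) < t" if "i \<ge> M" "j \<ge> M" for i j
      using less[of i j] less[of j i] that t by (cases i j rule: linorder_cases) (auto simp: dist_commute)
    then show "\<exists>M. \<forall>m\<ge>M. \<forall>n\<ge>M. dist (Y m) (Y n) < t" by blast
  qed
  then obtain p where p: "Y \<longlonglongrightarrow> p" using Cauchy_convergent convergent_def by blast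
  have "p \<in> closure (range A)"
    unfolding closure_sequential using p by (intro exI[of _ Y]) (simp add: Y_def)
  moreover have "inner p p \<le> inner (A x) p" for x
  proof -
    \<comment> \<open>Monotonicity between an arbitrary \<open>x\<close> and \<open>X n\<close>,
      scaled by \<open>e n\<close> so that \<open>e n *\<^sub>R X n\<close> becomes
      \<open>- Y n\<close>; the remaining term with \<open>e n\<close> vanishes in the
      limit.\<close>
    have le: "inner (Y n) (Y n) \<le> inner (A x) (Y n) + e n * inner x (A x - Y n)" for n
    proof -
      have "0 \<le> e n * inner (x - X n) (A x - Y n)"
        using mono[of x "X n"] e0[of n] by (simp add: Y_def)
      also have "\<dots> = e n * inner x (A x - Y n) + inner (Y n) (A x - Y n)"
        using e0[of n] by (subst XY) (simp add: inner_simps field_simps)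
      finally show ?thesis by (simp add: inner_simps inner_commute)
    qed
    have "e \<longlonglongrightarrow> 0" unfolding e_def by (rule LIMSEQ_inverse_real_of_nat)
    then have "(\<lambda>n. inner (A x) (Y n) + e n * inner x (A x - Y n)) \<longlonglongrightarrow>
        inner (A x) p + 0 * inner x (A x - p)"
      by (intro tendsto_intros p)
    moreover have "(\<lambda>n. inner (Y n) (Y n)) \<longlonglongrightarrow> inner p p" by (intro tendsto_intros p)
    ultimately show ?thesis using LIMSEQ_le[of "\<lambda>n. inner (Y n) (Y n)"] le by force
  qed
  then have "range A \<subseteq> {a. inner p p \<le> inner a p}" by auto
  then have "\<forall>a\<in>closure (range A). inner p p \<le> inner a p"
  proof -
    assume "range A \<subseteq> {a. inner p p \<le> inner a p}"
    moreover have "closed {a. inner p p \<le> inner a p}" by (intro closed_Collect_le continuous_intros)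
    ultimately show ?thesis using closure_minimal by blast
  qed
  ultimately show ?thesis by blast
qed

text \<open>The variational inequality bounds the squared norm of \<open>a - p\<close> by the
  difference of the squared norms of \<open>a\<close> and \<open>p\<close>, which yields minimality
  and uniqueness at once.\<close>

lemma metric_projection_zero_eqI:
  assumes "p \<in> D" "\<And>a. a \<in> D \<Longrightarrow> inner p p \<le> inner a p"
  shows "metric_projection D 0 = p"
  unfolding metric_projection_def
proof (rule the_equality)
  have eq: "(norm (a - p))\<^sup>2 \<le> (norm a)\<^sup>2 - (norm p)\<^sup>2" if "a \<in> D" for a
    using assms(2)[OF that] by (simp add: power2_norm_eq_inner inner_simps inner_commute)
  show "p \<in> D \<and> (\<forall>y\<in>D. dist 0 p \<le> dist 0 y)"
  proof (intro conjI ballI assms(1))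
    fix y assume "y \<in> D"
    then have "(norm p)\<^sup>2 \<le> (norm y)\<^sup>2" using eq[of y] zero_le_power2[of "norm (y - p)"] by linarith
    then show "dist 0 p \<le> dist 0 y" using power2_le_imp_le[of "norm p" "norm y"] by simp
  qed
  fix q assume q: "q \<in> D \<and> (\<forall>y\<in>D. dist 0 q \<le> dist 0 y)"
  then have "norm q \<le> norm p" using assms(1) by auto
  then have "(norm q)\<^sup>2 \<le> (norm p)\<^sup>2" by simp
  then have "(norm (q - p))\<^sup>2 \<le> 0" using eq[of q] q by linarith
  then show "q = p" by simp
qed

section \<open>Uniqueness of minimizers and sufficiency of the subdifferential inclusion\<close>

lemma uniformly_convex_midpoint_less:
  assumes "uniformly_convex_fun h" "h x = ereal r" "h y = ereal s" "x \<noteq> y"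
  obtains q where "h ((1/2) *\<^sub>R x + (1/2) *\<^sub>R y) = ereal q" "q < (r + s) / 2"
proof -
  obtain \<phi> where \<phi>: "uniformly_convex_with_modulus h \<phi>"
    using assms(1) by (auto simp: uniformly_convex_fun_def)
  obtain q where q: "h ((1/2) *\<^sub>R x + (1/2) *\<^sub>R y) = ereal q"
    "ereal q + ereal (1/4) * \<phi> (norm (x - y)) \<le> ereal ((r + s) / 2)"
    using uniformly_convexD[OF \<phi> assms(2,3)] .
  have "0 < norm (x - y)" using assms(4) by simp
  with \<phi> have "0 < \<phi> (norm (x - y))"
    unfolding uniformly_convex_with_modulus_def by (metis less_irrefl order_less_le)
  then have "q < (r + s) / 2" using q(2) by (cases "\<phi> (norm (x - y))") auto
  with that q(1) show ?thesis by blast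
qed

lemma convex_fun_midpoint_le:
  assumes "proper_fun h" "convex_fun h" "h x = ereal r" "h y = ereal s"
  obtains q where "h ((1/2) *\<^sub>R x + (1/2) *\<^sub>R y) = ereal q" "q \<le> (r + s) / 2"
  using convex_funD[OF assms, of "1/2"] by (auto simp: field_simps)

text \<open>At the midpoint of two distinct minimizers one of the two convex terms drops strictly,
  the other does not exceed its average, and the inner product term is affine. Finiteness at
  \<open>y\<close> is inherited from \<open>F y \<le> F x\<close>.\<close>

lemma minimizers_eq:
  fixes f g :: "'a::real_inner \<Rightarrow> ereal" and v :: 'a
  defines "F \<equiv> \<lambda>x. ereal (- inner x v) + f x + g (x - v)"
  assumes f: "proper_fun f" "convex_fun f" and g: "proper_fun g" "convex_fun g"
    and h: "uniformly_convex_fun f \<or> uniformly_convex_fun g"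
    and fin: "f x < \<infinity>" "g (x - v) < \<infinity>"
    and min: "\<And>z. F x \<le> F z" "\<And>z. F y \<le> F z"
  shows "x = y"
proof (rule ccontr)
  assume ne: "x \<noteq> y"
  obtain r where r: "f x = ereal r" using proper_fun_finite[OF f(1) fin(1)] .
  obtain r' where r': "g (x - v) = ereal r'" using proper_fun_finite[OF g(1) fin(2)] .
  have "F x = ereal (- inner x v + r + r')" using r r' by (simp add: F_def)
  then have "F y \<le> ereal (- inner x v + r + r')" using min(2)[of x] by simp
  then have "F y < \<infinity>" by (rule le_less_trans) simp
  then have "ereal (- inner y v) + f y + g (y - v) < \<infinity>" by (simp add: F_def)
  moreover have "f y \<noteq> -\<infinity>" "g (y - v) \<noteq> -\<infinity>" using f(1) g(1) by (auto simp: proper_fun_def)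
  ultimately have "f y < \<infinity>" "g (y - v) < \<infinity>"
    by (cases "f y"; cases "g (y - v)"; simp)+
  then obtain s s' where s: "f y = ereal s" and s': "g (y - v) = ereal s'"
    using proper_fun_finite f(1) g(1) by metis
  define m where "m = (1/2::real) *\<^sub>R x + (1/2::real) *\<^sub>R y"
  have m': "(1/2::real) *\<^sub>R (x - v) + (1/2::real) *\<^sub>R (y - v) = m - v"
  proof -
    have "v = (1/2::real) *\<^sub>R v + (1/2::real) *\<^sub>R v" by (simp flip: scaleR_add_left)
    then show ?thesis by (simp add: m_def algebra_simps)
  qed
  have ne': "x - v \<noteq> y - v" using ne by simp
  obtain q where q: "f m = ereal q" "q \<le> (r + s) / 2"
    using convex_fun_midpoint_le[OF f r s] unfolding m_def .
  obtain q' where q': "g (m - v) = ereal q'" "q' \<le> (r' + s') / 2"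
    using convex_fun_midpoint_le[OF g r' s'] unfolding m' .
  have "q < (r + s) / 2 \<or> q' < (r' + s') / 2"
    using h
  proof
    assume "uniformly_convex_fun f"
    from uniformly_convex_midpoint_less[OF this r s ne] q(1) show ?thesis
      unfolding m_def[symmetric] by auto
  next
    assume "uniformly_convex_fun g"
    from uniformly_convex_midpoint_less[OF this r' s' ne'] q'(1) show ?thesis
      unfolding m' by auto
  qed
  moreover have "inner m v = (inner x v + inner y v) / 2"
    by (simp add: m_def inner_simps field_simps)
  moreover have "- inner x v + r + r' \<le> - inner m v + q + q'"
    using min(1)[of m] r r' q(1) q'(1) by (simp add: F_def)
  moreover have "- inner y v + s + s' \<le> - inner m v + q + q'"
    using min(2)[of m] s s' q(1) q'(1) by (simp add: F_def)
  ultimately show False using q(2) q'(2) by argo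
qed

text \<open>The inequalities for \<open>u\<close> and \<open>v - u\<close> add up to one with slope
  \<open>v\<close>, which the linear term cancels.\<close>

lemma subdifferential_sum_minimizer:
  assumes "proper_fun f" "proper_fun g"
    and u: "u \<in> subdifferential f x" and w: "v - u \<in> subdifferential g (x - v)"
  shows "ereal (- inner x v) + f x + g (x - v) \<le> ereal (- inner y v) + f y + g (y - v)"
proof -
  obtain r where r: "f x = ereal r" using subdifferential_finite[OF assms(1) u] .
  obtain s where s: "g (x - v) = ereal s" using subdifferential_finite[OF assms(2) w] .
  consider "f y = \<infinity>" | "g (y - v) = \<infinity>"
    | p q where "f y = ereal p" "g (y - v) = ereal q"
    using assms(1,2) by (cases "f y"; cases "g (y - v)") (auto simp: proper_fun_def)
  then show ?thesis
  proof cases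
    case 3
    have "inner (y - x) u + r \<le> p" using subdifferentialD[OF u r 3(1)] .
    moreover have "inner (y - v - (x - v)) (v - u) + s \<le> q" using subdifferentialD[OF w s 3(2)] .
    ultimately show ?thesis using r s 3 by (simp add: inner_simps)
  next
    case 1
    then show ?thesis using assms(2) by (simp add: proper_fun_def)
  next
    case 2
    then show ?thesis using assms(1) by (simp add: proper_fun_def)
  qed
qed

section \<open>The Douglas-Rachford displacement operator and its cocoercivity\<close>

definition dr_displacement :: "('a::real_inner \<Rightarrow> ereal) \<Rightarrow> ('a \<Rightarrow> ereal) \<Rightarrow> 'a \<Rightarrow> 'a" where
  "dr_displacement f g x = Prox f x - Prox g (reflected_prox f x)"

text \<open>Each residual \<open>x - Prox f x\<close> is a subgradient at \<open>Prox f x\<close>,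
  and likewise for \<open>g\<close> at the reflected point, so the summands are the monotonicity
  gaps of the two subdifferentials.\<close>

definition dr_gap :: "('a::real_inner \<Rightarrow> ereal) \<Rightarrow> ('a \<Rightarrow> ereal) \<Rightarrow> 'a \<Rightarrow> 'a \<Rightarrow> real" where
  "dr_gap f g x y =
     inner (Prox f x - Prox f y) ((x - Prox f x) - (y - Prox f y)) +
     inner (Prox g (reflected_prox f x) - Prox g (reflected_prox f y))
       ((reflected_prox f x - Prox g (reflected_prox f x)) -
        (reflected_prox f y - Prox g (reflected_prox f y)))"

text \<open>Pure algebra: with \<open>a\<close> and \<open>b\<close> the differences of the proximal
  points, the argument of \<open>Prox g\<close> changes by \<open>2a - (x - y)\<close>, and the
  terms quadratic in \<open>a\<close> and \<open>b\<close> cancel.\<close>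

lemma dr_displacement_inner:
  "inner (x - y) (dr_displacement f g x - dr_displacement f g y)
     = (norm (dr_displacement f g x - dr_displacement f g y))\<^sup>2 + dr_gap f g x y"
proof -
  define a b where "a = Prox f x - Prox f y"
    and "b = Prox g (reflected_prox f x) - Prox g (reflected_prox f y)"
  have A: "dr_displacement f g x - dr_displacement f g y = a - b"
    by (simp add: dr_displacement_def a_def b_def)
  have "(x - Prox f x) - (y - Prox f y) = (x - y) - a"
    "(reflected_prox f x - Prox g (reflected_prox f x)) -
        (reflected_prox f y - Prox g (reflected_prox f y)) = a + a - (x - y) - b"
    by (simp_all add: a_def b_def reflected_prox_def scaleR_2)
  then have "dr_gap f g x y = inner a ((x - y) - a) + inner b (a + a - (x - y) - b)"
    unfolding dr_gap_def by (simp only: a_def[symmetric] b_def[symmetric])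
  then show ?thesis
    unfolding A power2_norm_eq_inner
    by (simp add: inner_diff_left inner_diff_right inner_add_right inner_commute)
qed

context
  fixes f g :: "'a::{real_inner, complete_space} \<Rightarrow> ereal"
  assumes f: "proper_fun f" "lsc_fun f" "convex_fun f"
    and g: "proper_fun g" "lsc_fun g" "convex_fun g"
begin

lemma dr_gap_terms_nonneg:
  "0 \<le> inner (Prox f x - Prox f y) ((x - Prox f x) - (y - Prox f y))"
  "0 \<le> inner (Prox g (reflected_prox f x) - Prox g (reflected_prox f y))
       ((reflected_prox f x - Prox g (reflected_prox f x)) -
        (reflected_prox f y - Prox g (reflected_prox f y)))"
  by (intro subdifferential_monotone[OF f(1)] subdifferential_monotone[OF g(1)]
      Prox_subdifferential f g)+

lemma dr_gap_nonneg: "0 \<le> dr_gap f g x y"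
  unfolding dr_gap_def using dr_gap_terms_nonneg by (rule add_nonneg_nonneg)

lemma dr_displacement_cocoercive:
  "(norm (dr_displacement f g x - dr_displacement f g y))\<^sup>2
     \<le> inner (x - y) (dr_displacement f g x - dr_displacement f g y)"
  unfolding dr_displacement_inner using dr_gap_nonneg by simp

text \<open>The gap dominates the modulus of whichever function is uniformly convex. For
  \<open>g\<close> this controls the second proximal points, and the displacement differences carry
  the convergence over to the first.\<close>

lemma Prox_diff_tendsto_zero:
  assumes h: "uniformly_convex_fun f \<or> uniformly_convex_fun g"
    and gap: "(\<lambda>n. dr_gap f g (X n) (Y n)) \<longlonglongrightarrow> 0"
    and displ: "(\<lambda>n. dr_displacement f g (X n) - dr_displacement f g (Y n)) \<longlonglongrightarrow> 0"
  shows "(\<lambda>n. Prox f (X n) - Prox f (Y n)) \<longlonglongrightarrow> 0"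
  using h
proof
  assume "uniformly_convex_fun f"
  then obtain \<phi> where \<phi>: "uniformly_convex_with_modulus f \<phi>"
    by (auto simp: uniformly_convex_fun_def)
  show ?thesis
  proof (rule uniformly_convex_modulus_tendsto[OF \<phi> _ gap])
    fix n
    have "\<phi> (norm (Prox f (X n) - Prox f (Y n))) \<le>
        ereal (inner (Prox f (X n) - Prox f (Y n)) ((X n - Prox f (X n)) - (Y n - Prox f (Y n))))"
      by (intro uniformly_convex_subdifferential[OF \<phi>] Prox_subdifferential f)
    also have "\<dots> \<le> ereal (dr_gap f g (X n) (Y n))"
      unfolding dr_gap_def using dr_gap_terms_nonneg(2) by simp
    finally show "\<phi> (norm (Prox f (X n) - Prox f (Y n))) \<le> ereal (dr_gap f g (X n) (Y n))" .
  qed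
next
  let ?Q = "\<lambda>x. Prox g (reflected_prox f x)"
  assume "uniformly_convex_fun g"
  then obtain \<phi> where \<phi>: "uniformly_convex_with_modulus g \<phi>"
    by (auto simp: uniformly_convex_fun_def)
  have "(\<lambda>n. ?Q (X n) - ?Q (Y n)) \<longlonglongrightarrow> 0"
  proof (rule uniformly_convex_modulus_tendsto[OF \<phi> _ gap])
    fix n
    have "\<phi> (norm (?Q (X n) - ?Q (Y n))) \<le>
        ereal (inner (?Q (X n) - ?Q (Y n))
          ((reflected_prox f (X n) - ?Q (X n)) - (reflected_prox f (Y n) - ?Q (Y n))))"
      by (intro uniformly_convex_subdifferential[OF \<phi>] Prox_subdifferential g)
    also have "\<dots> \<le> ereal (dr_gap f g (X n) (Y n))"
      unfolding dr_gap_def using dr_gap_terms_nonneg(1) by simp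
    finally show "\<phi> (norm (?Q (X n) - ?Q (Y n))) \<le> ereal (dr_gap f g (X n) (Y n))" .
  qed
  from tendsto_add[OF displ this] show ?thesis
    by (simp add: dr_displacement_def)
qed

section \<open>Asymptotics of two relaxed orbits\<close>

lemma dr_iteration_decrease:
  "(norm ((x - (2 * l) *\<^sub>R dr_displacement f g x) - (y - (2 * l) *\<^sub>R dr_displacement f g y)))\<^sup>2
     = (norm (x - y))\<^sup>2
       - 4 * l * (1 - l) * (norm (dr_displacement f g x - dr_displacement f g y))\<^sup>2
       - 4 * l * dr_gap f g x y"
proof -
  define d where "d = dr_displacement f g x - dr_displacement f g y"
  have eq: "(x - (2 * l) *\<^sub>R dr_displacement f g x) - (y - (2 * l) *\<^sub>R dr_displacement f g y)
      = (x - y) - (2 * l) *\<^sub>R d"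
    by (simp add: d_def algebra_simps)
  have "(norm ((x - y) - (2 * l) *\<^sub>R d))\<^sup>2
      = (norm (x - y))\<^sup>2 - 4 * l * inner (x - y) d + 4 * l\<^sup>2 * (norm d)\<^sup>2"
    unfolding power2_norm_eq_inner
    by (simp add: inner_diff_left[of "x - y"] inner_diff_right[of _ "x - y"] inner_commute
        power2_eq_square)
  also have "inner (x - y) d = (norm d)\<^sup>2 + dr_gap f g x y"
    unfolding d_def by (rule dr_displacement_inner)
  finally show ?thesis
    unfolding eq unfolding d_def[symmetric] by (simp add: algebra_simps power2_eq_square)
qed

text \<open>The squared distance of the orbits decreases and is nonnegative, so its successive
  differences tend to 0. Both quantities are dominated by multiples of these differences, since
  \<open>0 < l < 1\<close> makes their coefficients positive.\<close>

lemma dr_iteration_asymptotics: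
  assumes l: "0 < l" "l < 1"
    and X: "\<And>n. X (Suc n) = X n - (2 * l) *\<^sub>R dr_displacement f g (X n)"
    and Y: "\<And>n. Y (Suc n) = Y n - (2 * l) *\<^sub>R dr_displacement f g (Y n)"
  shows "(\<lambda>n. dr_gap f g (X n) (Y n)) \<longlonglongrightarrow> 0"
    and "(\<lambda>n. dr_displacement f g (X n) - dr_displacement f g (Y n)) \<longlonglongrightarrow> 0"
proof -
  define d where "d n = dr_displacement f g (X n) - dr_displacement f g (Y n)" for n
  define u where "u n = (norm (X n - Y n))\<^sup>2" for n
  have eq: "u n - u (Suc n) = 4 * l * (1 - l) * (norm (d n))\<^sup>2 + 4 * l * dr_gap f g (X n) (Y n)" for n
    unfolding u_def X Y using dr_iteration_decrease[of "X n" l "Y n"] by (simp add: d_def)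
  have c: "0 < 4 * l * (1 - l)" "0 < 4 * l" using l by auto
  have nn: "0 \<le> 4 * l * (1 - l) * (norm (d n))\<^sup>2" "0 \<le> 4 * l * dr_gap f g (X n) (Y n)" for n
    using c dr_gap_nonneg by (auto intro!: mult_nonneg_nonneg)
  have "decseq u"
    unfolding decseq_Suc_iff using eq nn by (smt (verit))
  then obtain L where L: "u \<longlonglongrightarrow> L"
    using decseq_convergent[of u 0] by (auto simp: u_def)
  then have "(\<lambda>n. u n - u (Suc n)) \<longlonglongrightarrow> L - L" by (intro tendsto_diff LIMSEQ_Suc)
  then have lim: "(\<lambda>n. (u n - u (Suc n)) / k) \<longlonglongrightarrow> 0" for k
    using tendsto_divide_zero by fastforce
  show "(\<lambda>n. dr_gap f g (X n) (Y n)) \<longlonglongrightarrow> 0"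
  proof (rule tendsto_sandwich[OF _ _ tendsto_const lim[of "4 * l"]])
    show "\<forall>\<^sub>F n in sequentially. dr_gap f g (X n) (Y n) \<le> (u n - u (Suc n)) / (4 * l)"
      using nn(1) c(2) by (intro always_eventually allI) (simp add: eq field_simps)
  qed (simp add: dr_gap_nonneg)
  have "(\<lambda>n. (norm (d n))\<^sup>2) \<longlonglongrightarrow> 0"
  proof (rule tendsto_sandwich[OF _ _ tendsto_const lim[of "4 * l * (1 - l)"]])
    show "\<forall>\<^sub>F n in sequentially. (norm (d n))\<^sup>2 \<le> (u n - u (Suc n)) / (4 * l * (1 - l))"
      using nn(2) c(1) by (intro always_eventually allI) (simp add: eq pos_le_divide_eq mult.commute)
  qed simp
  then have "d \<longlonglongrightarrow> 0"
    using tendsto_norm_zero_iff tendsto_null_power[of "\<lambda>n. norm (d n)"] tendsto_real_sqrt by fastforce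
  then show "(\<lambda>n. dr_displacement f g (X n) - dr_displacement f g (Y n)) \<longlonglongrightarrow> 0"
    by (simp add: d_def[abs_def])
qed

text \<open>The limit point of the regularization satisfies the variational inequality, hence it is
  the nearest point and equals \<open>v\<close>.\<close>

lemma dr_displacement_projection:
  assumes "v = metric_projection (closure (range (dr_displacement f g))) 0"
  shows "inner v v \<le> inner v (dr_displacement f g x)"
proof -
  obtain p where "p \<in> closure (range (dr_displacement f g))"
    "\<And>a. a \<in> closure (range (dr_displacement f g)) \<Longrightarrow> inner p p \<le> inner a p"
    using cocoercive_minimal_displacement[OF dr_displacement_cocoercive] by blast
  moreover from this have "v = p" unfolding assms by (rule metric_projection_zero_eqI)
  ultimately show ?thesis
    using closure_subset by (metis inner_commute rangeI subsetD)
qed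

text \<open>Along the ray \<open>y - s v\<close>, cocoercivity reads \<open>\<parallel>A(y - s v) - v\<parallel>\<^sup>2 \<le> s \<langle>v, v - A(y - s v)\<rangle>\<close>, and the
  right-hand side is nonpositive by the variational characterization of \<open>v\<close>.\<close>

lemma dr_displacement_ray:
  assumes v: "\<And>x. inner v v \<le> inner v (dr_displacement f g x)"
    and y: "dr_displacement f g y = v" and s: "0 \<le> s"
  shows "dr_displacement f g (y - s *\<^sub>R v) = v" "dr_gap f g (y - s *\<^sub>R v) y = 0"
proof -
  let ?a = "dr_displacement f g (y - s *\<^sub>R v)"
  have "0 \<le> s * inner v (?a - v)" using v[of "y - s *\<^sub>R v"] s by (simp add: inner_diff_right)
  then have "(norm (?a - v))\<^sup>2 + dr_gap f g (y - s *\<^sub>R v) y \<le> 0"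
    using dr_displacement_inner[of "y - s *\<^sub>R v" y f g] y by simp
  then have "(norm (?a - v))\<^sup>2 = 0" "dr_gap f g (y - s *\<^sub>R v) y = 0"
    using dr_gap_nonneg[of "y - s *\<^sub>R v" y] zero_le_power2[of "norm (?a - v)"] by linarith+
  then show "?a = v" "dr_gap f g (y - s *\<^sub>R v) y = 0" by simp_all
qed

text \<open>On the ray the gap and the displacement difference are 0, so the convergence lemma
  applies to constant sequences, and a constant sequence tending to 0 is 0.\<close>

lemma Prox_ray:
  assumes "uniformly_convex_fun f \<or> uniformly_convex_fun g"
    and "\<And>x. inner v v \<le> inner v (dr_displacement f g x)"
    and "dr_displacement f g y = v" "0 \<le> s"
  shows "Prox f (y - s *\<^sub>R v) = Prox f y"
proof -
  note ray = dr_displacement_ray[OF assms(2-4)]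
  have "(\<lambda>n::nat. Prox f (y - s *\<^sub>R v) - Prox f y) \<longlonglongrightarrow> 0"
    by (rule Prox_diff_tendsto_zero[OF assms(1)]) (simp_all add: ray assms(3))
  then show ?thesis by (simp add: LIMSEQ_const_iff)
qed

end

theorem theorem5p3:
  fixes f g :: "'a::{real_inner, complete_space} \<Rightarrow> ereal"
    and lam :: real
    and T T\<^sub>l :: "'a \<Rightarrow> 'a"
    and v :: 'a
    and Z :: "'a set"
  assumes f: "proper_fun f" "lsc_fun f" "convex_fun f"
    and g: "proper_fun g" "lsc_fun g" "convex_fun g"
    and lam: "0 < lam" "lam < 1"
    and T\<^sub>l: "T\<^sub>l = (\<lambda>x. (1 - lam) *\<^sub>R x + lam *\<^sub>R reflected_prox g (reflected_prox f x))"
    and T: "T = (\<lambda>x. (1/2) *\<^sub>R (x + reflected_prox g (reflected_prox f x)))"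
    and v: "v = metric_projection (closure (range (\<lambda>x. x - T x))) 0"
    and Z: "Z = {x. 0 \<in> {- v} + subdifferential f x + subdifferential g (x - v)}"
    and Z_nonempty: "Z \<noteq> {}"
    and h: "\<exists>h\<in>{f, g}. uniformly_convex_fun h"
  shows "\<exists>xbar.
      Z = argmin_set (\<lambda>x. ereal (- inner x v) + f x + g (x - v)) \<and>
      Z = {xbar} \<and>
      (\<forall>x. (\<lambda>n. Prox f ((T\<^sub>l ^^ n) x)) \<longlonglongrightarrow> xbar \<and>
           (\<lambda>n. Prox g (reflected_prox f ((T\<^sub>l ^^ n) x))) \<longlonglongrightarrow> xbar - v)"
proof -
  define F where "F = (\<lambda>x. ereal (- inner x v) + f x + g (x - v))"
  define A where "A = dr_displacement f g"
  have h': "uniformly_convex_fun f \<or> uniformly_convex_fun g" using h by auto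
  have "x - T x = A x" for x
  proof -
    have "x + reflected_prox g (reflected_prox f x) = 2 *\<^sub>R (x - A x)"
      unfolding A_def dr_displacement_def reflected_prox_def[of g]
      by (simp add: reflected_prox_def[of f] scaleR_2)
    then have "T x = (1/2::real) *\<^sub>R (2 *\<^sub>R (x - A x))" by (simp only: T)
    then show ?thesis by simp
  qed
  then have v_inner: "inner v v \<le> inner v (A x)" for x
    unfolding A_def using v by (intro dr_displacement_projection[OF f g]) (simp add: A_def)
  have T\<^sub>l_eq: "T\<^sub>l x = x - (2 * lam) *\<^sub>R A x" for x
    by (simp add: T\<^sub>l A_def dr_displacement_def reflected_prox_def algebra_simps scaleR_2
        flip: scaleR_scaleR)
  have Z_iff: "x \<in> Z \<longleftrightarrow> (\<exists>u. u \<in> subdifferential f x \<and> v - u \<in> subdifferential g (x - v))" for x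
  proof
    assume "x \<in> Z"
    then obtain u w where uw: "u \<in> subdifferential f x" "w \<in> subdifferential g (x - v)"
      "0 = - v + u + w"
      unfolding Z by (auto simp: set_plus_def)
    then have "w = v - u" by (simp add: algebra_simps)
    with uw show "\<exists>u. u \<in> subdifferential f x \<and> v - u \<in> subdifferential g (x - v)" by blast
  next
    assume "\<exists>u. u \<in> subdifferential f x \<and> v - u \<in> subdifferential g (x - v)"
    then obtain u where u: "u \<in> subdifferential f x" "v - u \<in> subdifferential g (x - v)" by blast
    have "- v + u + (v - u) \<in> {- v} + subdifferential f x + subdifferential g (x - v)"
      by (intro set_plus_intro u) simp
    then show "x \<in> Z" by (simp add: Z)
  qed
  obtain z where zZ: "z \<in> Z" using Z_nonempty by blast
  then obtain u where u: "u \<in> subdifferential f z" "v - u \<in> subdifferential g (z - v)"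
    using Z_iff by blast
  have argmin_iff: "x \<in> argmin_set F \<longleftrightarrow> (\<forall>y. F x \<le> F y)" for x
    by (auto simp: argmin_set_def is_arg_min_def not_less)
  have Z_argmin: "x \<in> argmin_set F" if "x \<in> Z" for x
  proof -
    from that obtain w where "w \<in> subdifferential f x" "v - w \<in> subdifferential g (x - v)"
      using Z_iff by blast
    from subdifferential_sum_minimizer[OF f(1) g(1) this] have "\<forall>y. F x \<le> F y"
      unfolding F_def by blast
    then show ?thesis unfolding argmin_iff .
  qed
  have fin: "f z < \<infinity>" "g (z - v) < \<infinity>"
    by (rule subdifferential_finite[OF f(1) u(1)], simp)
      (rule subdifferential_finite[OF g(1) u(2)], simp)
  \<comment> \<open>This closes the chain of inclusions from \<open>{z}\<close> to \<open>Z\<close>,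
    to \<open>argmin_set F\<close>, and back to \<open>{z}\<close>.\<close>
  have "x = z" if "x \<in> argmin_set F" for x
  proof -
    have "\<forall>y. F x \<le> F y" "\<forall>y. F z \<le> F y"
      using that Z_argmin[OF zZ] unfolding argmin_iff by blast+
    then show ?thesis
      using minimizers_eq[OF f(1,3) g(1,3) h' fin, of x] unfolding F_def by simp
  qed
  then have sets: "Z = {z}" "Z = argmin_set F" using Z_argmin zZ by blast+
  \<comment> \<open>Adding the subgradient makes \<open>z\<close> the proximal point of
    \<open>y\<close>. The reflection is then \<open>z - u\<close>, and
    \<open>(z - u) - (z - v) = v - u\<close> identifies the second proximal point as
    \<open>z - v\<close>.\<close>
  define y where "y = z + u"
  have Py: "Prox f y = z" using u(1) by (intro Prox_eqI f) (simp add: y_def)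
  have Ry: "reflected_prox f y = z - u" unfolding reflected_prox_def Py by (simp add: y_def scaleR_2)
  have "Prox g (reflected_prox f y) = z - v"
    unfolding Ry using u(2) by (intro Prox_eqI g) simp
  then have Ay: "A y = v" by (simp add: A_def dr_displacement_def Py)
  have limits: "(\<lambda>n. Prox f ((T\<^sub>l ^^ n) x)) \<longlonglongrightarrow> z"
      "(\<lambda>n. Prox g (reflected_prox f ((T\<^sub>l ^^ n) x))) \<longlonglongrightarrow> z - v" for x
  proof -
    define X where "X n = (T\<^sub>l ^^ n) x" for n
    \<comment> \<open>The reference orbit of \<open>y\<close> in closed form: each step of
      \<open>T\<^sub>l\<close> subtracts \<open>2 * lam\<close> times the displacement, which stays
      \<open>v\<close> along the ray.\<close>
    define Y where "Y n = y - (2 * lam * real n) *\<^sub>R v" for n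
    have AY: "A (Y n) = v" and PY: "Prox f (Y n) = z" for n
      using dr_displacement_ray(1)[OF f g, of v y "2 * lam * real n"]
        Prox_ray[OF f g h', of v y "2 * lam * real n"] v_inner Ay lam Py
      by (simp_all add: Y_def A_def)
    have XS: "X (Suc n) = X n - (2 * lam) *\<^sub>R A (X n)" for n by (simp add: X_def T\<^sub>l_eq)
    have YS: "Y (Suc n) = Y n - (2 * lam) *\<^sub>R A (Y n)" for n
      unfolding AY by (simp add: Y_def algebra_simps)
    note asym = dr_iteration_asymptotics[where X = X and Y = Y, OF f g lam XS[unfolded A_def] YS[unfolded A_def]]
    have "(\<lambda>n. Prox f (X n) - z) \<longlonglongrightarrow> 0"
      using Prox_diff_tendsto_zero[OF f g h' asym] by (simp add: PY)
    then have P: "(\<lambda>n. Prox f (X n)) \<longlonglongrightarrow> z" by (simp add: LIM_zero_iff)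
    \<comment> \<open>The second limit is the first minus the limit \<open>v\<close> of the
      displacements.\<close>
    have "(\<lambda>n. A (X n) - v) \<longlonglongrightarrow> 0" using asym(2) AY by (simp add: A_def)
    then have "(\<lambda>n. A (X n)) \<longlonglongrightarrow> v" by (simp add: LIM_zero_iff)
    from tendsto_diff[OF P this] have "(\<lambda>n. Prox g (reflected_prox f (X n))) \<longlonglongrightarrow> z - v"
      by (simp add: A_def dr_displacement_def)
    with P show "(\<lambda>n. Prox f ((T\<^sub>l ^^ n) x)) \<longlonglongrightarrow> z"
      "(\<lambda>n. Prox g (reflected_prox f ((T\<^sub>l ^^ n) x))) \<longlonglongrightarrow> z - v"
      by (simp_all add: X_def)
  qed
  show ?thesis
    using sets limits unfolding F_def by blast
qed

end
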